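(* Define $a(1)=1$ and $a(n)=1+\sum_m a(m)$ for $n>1$, the sum over all proper divisors $m$ of $n$ (positive divisors $m<n$). Let $p,q,r$ be distinct primes and $c,d,e$ positive integers. Then $$a(p^c)=2a(p^{c-1}),$$ $$a(p^cq^d)=2\big(a(p^{c-1}q^d)+a(p^cq^{d-1})-a(p^{c-1}q^{d-1})\big),$$ $$a(p^cq^dr^e)=2\big(a(p^{c-1}q^dr^e)+a(p^cq^{d-1}r^e)+a(p^cq^dr^{e-1})-a(p^cq^{d-1}r^{e-1})-a(p^{c-1}q^dr^{e-1})-a(p^{c-1}q^{d-1}r^e)+a(p^{c-1}q^{d-1}r^{e-1})\big).$$
   Context: $a(n)$ is called the number of recursive divisors of $n$. *)

theory Defs
  imports "HOL-Computational_Algebra.Primes"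
begin

(* The value at 0 is a convention: the mathematical function is defined for n \<ge> 1 only. *)
function num_rec_divisors :: "nat \<Rightarrow> nat" where
  "num_rec_divisors n =
     (if n = 0 then 0
      else if n = 1 then 1
      else 1 + (\<Sum>m | m dvd n \<and> m < n. num_rec_divisors m))"
  by pat_completeness auto
termination
  by (relation "measure id") auto

declare num_rec_divisors.simps [simp del]

(* Integer-valued, because the recurrences involve genuine subtraction. *)
abbreviation recdiv :: "nat \<Rightarrow> int" where
  "recdiv n \<equiv> int (num_rec_divisors n)"

end

theory Submission
  imports Defs
begin

text \<open>
  Summing over all divisors instead of the proper ones, the definition reads
  \<open>\<Sum>m | m dvd n. a m = 2 * a n - 1\<close>, for \<open>n = 1\<close> too. Taking differences of both
  sides in each of the prime exponents leaves only the top term \<open>a n\<close> on the left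
  and removes the constant \<open>- 1\<close> on the right; solving for \<open>a n\<close> gives the recurrences.
\<close>

lemma sum_divisors_recdiv:
  assumes "n > 0"
  shows "(\<Sum>m | m dvd n. recdiv m) = 2 * recdiv n - 1"
proof (cases "n = 1")
  case True
  have "num_rec_divisors 1 = 1"
    by (subst num_rec_divisors.simps) simp
  with True show ?thesis
    by simp
next
  case False
  have fin: "finite {m. m dvd n \<and> m < n}"
    by simp
  have "recdiv n = 1 + (\<Sum>m | m dvd n \<and> m < n. recdiv m)"
    using assms False by (subst num_rec_divisors.simps) simp
  moreover have "{m. m dvd n} = insert n {m. m dvd n \<and> m < n}"
    using assms by (auto dest: dvd_imp_le)
  ultimately show ?thesis
    using fin by simp
qed

text \<open>This is the difference in the exponent of one prime. As \<open>p\<close> does not divide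
  \<open>m\<close>, the divisors gained in passing from \<open>p ^ k * m\<close> to
  \<open>p ^ Suc k * m\<close> are those containing the full power \<open>p ^ Suc k\<close>. Leaving
  \<open>f\<close> arbitrary allows iteration over further primes.\<close>

lemma sum_divisors_prime_power_Suc_mult:
  fixes f :: "nat \<Rightarrow> 'a :: comm_monoid_add" and p m k :: nat
  assumes p: "prime p" and "\<not> p dvd m"
  shows "(\<Sum>x | x dvd p ^ Suc k * m. f x) =
         (\<Sum>x | x dvd p ^ k * m. f x) + (\<Sum>y | y dvd m. f (p ^ Suc k * y))"
proof -
  have pos: "p > 0" "m > 0"
    using assms by (auto simp: prime_gt_0_nat intro: Nat.gr0I)
  let ?A = "{x. x dvd p ^ k * m}" and ?B = "(*) (p ^ Suc k) ` {y. y dvd m}"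
  have "{x. x dvd p ^ Suc k * m} = ?A \<union> ?B"
  proof (intro equalityI subsetI)
    fix x assume "x \<in> {x. x dvd p ^ Suc k * m}"
    then obtain a b where ab: "x = a * b" "a dvd p ^ Suc k" "b dvd m"
      by (auto dest: division_decomp)
    then obtain i where "i \<le> Suc k" "a = p ^ i"
      using divides_primepow_nat[OF p] by blast
    \<comment> \<open>The exponent of the \<open>p\<close>-part decides: \<open>i = Suc k\<close>
      puts \<open>x\<close> into \<open>?B\<close>, a smaller \<open>i\<close> into
      \<open>?A\<close>.\<close>
    with ab show "x \<in> ?A \<union> ?B"
      by (cases "i = Suc k") (auto intro!: mult_dvd_mono simp: le_imp_power_dvd)
  next
    fix x assume "x \<in> ?A \<union> ?B"
    then show "x \<in> {x. x dvd p ^ Suc k * m}"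
      by (auto intro: dvd_mult mult_dvd_mono simp: mult.assoc)
  qed
  moreover have "?A \<inter> ?B = {}"
  proof -
    have "p dvd m" if "p ^ Suc k * y dvd p ^ k * m" for y
    proof -
      have "p ^ k * (p * y) dvd p ^ k * m"
        using that by (simp add: ac_simps)
      then have "p * y dvd m"
        using pos by simp
      then show ?thesis
        by (rule dvd_mult_left)
    qed
    with assms(2) show ?thesis
      by blast
  qed
  moreover have "finite ?A" "finite ?B"
    using pos by simp_all
  moreover have "inj_on ((*) (p ^ Suc k)) {y. y dvd m}"
    using pos by (auto intro: inj_onI)
  ultimately show ?thesis
    by (simp add: sum.union_disjoint sum.reindex)
qed

theorem theorem4:
  fixes p q r c d e :: nat
  assumes "prime p" and "prime q" and "prime r"
    and "p \<noteq> q" and "p \<noteq> r" and "q \<noteq> r"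
    and "c > 0" and "d > 0" and "e > 0"
  shows "recdiv (p ^ c) = 2 * recdiv (p ^ (c - 1)) \<and>
         recdiv (p ^ c * q ^ d) =
           2 * (recdiv (p ^ (c - 1) * q ^ d) + recdiv (p ^ c * q ^ (d - 1))
                - recdiv (p ^ (c - 1) * q ^ (d - 1))) \<and>
         recdiv (p ^ c * q ^ d * r ^ e) =
           2 * (recdiv (p ^ (c - 1) * q ^ d * r ^ e) + recdiv (p ^ c * q ^ (d - 1) * r ^ e)
                + recdiv (p ^ c * q ^ d * r ^ (e - 1))
                - recdiv (p ^ c * q ^ (d - 1) * r ^ (e - 1))
                - recdiv (p ^ (c - 1) * q ^ d * r ^ (e - 1))
                - recdiv (p ^ (c - 1) * q ^ (d - 1) * r ^ e)
                + recdiv (p ^ (c - 1) * q ^ (d - 1) * r ^ (e - 1)))"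
proof -
  have pos: "p > 0" "q > 0" "r > 0"
    using assms(1-3) by (simp_all add: prime_gt_0_nat)
  obtain c' d' e' where cde: "c = Suc c'" "d = Suc d'" "e = Suc e'"
    using assms(7-9) by (metis gr0_implies_Suc)
  have npq: "\<not> p dvd q ^ i" and npr: "\<not> p dvd r ^ j" and nqr: "\<not> q dvd r ^ j" for i j
    using assms(1-6) by (blast dest: prime_dvd_power primes_dvd_imp_eq)+
  have npqr: "\<not> p dvd q ^ i * r ^ j" for i j
    using npq npr assms(1) by (simp add: prime_dvd_mult_iff)
  have n1: "\<not> p dvd 1" "\<not> q dvd 1" "\<not> r dvd 1"
    using assms(1-3) not_prime_unit by blast+

  note diff = sum_divisors_prime_power_Suc_mult
  note D1 = diff[OF assms(1) n1(1), where f = recdiv and k = c']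
  \<comment> \<open>The \<open>p\<close>-difference leaves a sum over the divisors of the cofactor,
    weighted by \<open>recdiv (p ^ Suc c' * x)\<close>; this weight is the \<open>f\<close> of the
    next difference. The last prime has cofactor 1, so a single term remains.\<close>
  note D2 = diff[OF assms(1) npq, where f = recdiv and k = c']
    diff[OF assms(2) n1(2), where f = "\<lambda>x. recdiv (p ^ Suc c' * x)" and k = d']
  note D3 = diff[OF assms(1) npqr, where f = recdiv and k = c']
    diff[OF assms(2) nqr, where f = "\<lambda>x. recdiv (p ^ Suc c' * x)" and k = d']
    diff[OF assms(3) n1(3),
      where f = "\<lambda>x. recdiv (p ^ Suc c' * (q ^ Suc d' * x))" and k = e']
  \<comment> \<open>Keeps \<open>p ^ Suc c'\<close> a power, so that the equations \<open>S\<close>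
    apply to it.\<close>
  note [simp del] = power_Suc
  have S: "(\<Sum>x | x dvd p ^ i. recdiv x) = 2 * recdiv (p ^ i) - 1"
    "(\<Sum>x | x dvd p ^ i * q ^ j. recdiv x) = 2 * recdiv (p ^ i * q ^ j) - 1"
    "(\<Sum>x | x dvd p ^ i * (q ^ j * r ^ k). recdiv x) = 2 * recdiv (p ^ i * (q ^ j * r ^ k)) - 1"
    for i j k
    by (rule sum_divisors_recdiv; simp add: pos)+
  have "recdiv (p ^ c) = 2 * recdiv (p ^ (c - 1))"
    using D1 by (simp add: S cde)
  moreover have "recdiv (p ^ c * q ^ d) =
      2 * (recdiv (p ^ (c - 1) * q ^ d) + recdiv (p ^ c * q ^ (d - 1))
           - recdiv (p ^ (c - 1) * q ^ (d - 1)))"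
    \<comment> \<open>The \<open>p\<close>-differences at \<open>q ^ d\<close> and
      \<open>q ^ d'\<close> are subtracted; \<open>D2(2)\<close> identifies the result as the top
      term.\<close>
    using D2(1)[of d] D2(1)[of d'] D2(2) by (simp add: S cde)
  moreover have "recdiv (p ^ c * q ^ d * r ^ e) =
      2 * (recdiv (p ^ (c - 1) * q ^ d * r ^ e) + recdiv (p ^ c * q ^ (d - 1) * r ^ e)
           + recdiv (p ^ c * q ^ d * r ^ (e - 1))
           - recdiv (p ^ c * q ^ (d - 1) * r ^ (e - 1))
           - recdiv (p ^ (c - 1) * q ^ d * r ^ (e - 1))
           - recdiv (p ^ (c - 1) * q ^ (d - 1) * r ^ e)
           + recdiv (p ^ (c - 1) * q ^ (d - 1) * r ^ (e - 1)))"
    \<comment> \<open>Four \<open>p\<close>-differences, two \<open>q\<close>-differences and one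
      \<open>r\<close>-difference combine into the alternating sum over the eight exponent triples,
      in which the constants cancel.\<close>
    using D3(1)[of d e] D3(1)[of d' e] D3(1)[of d e'] D3(1)[of d' e']
      D3(2)[of e] D3(2)[of e'] D3(3)
    by (simp add: S cde mult.assoc)
  ultimately show ?thesis
    by blast
qed

end
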